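(* Let the training set $\mathcal{D}_{train}$ have the long-tailed label distribution $\mathbb{P}(Y=y_i)=\frac{\lambda}{e^{-\lambda}-e^{-\lambda C}}\,e^{-\lambda y_i}$, $y_i\in[1,C]$, where $\lambda=\frac{\ln\rho}{C-1}$. When $\xi\sim Beta(\alpha,\alpha)$, $\alpha\in[0,1]$, the newly mixed dataset $\mathcal{D}_\nu$ composed of $\xi$-Aug samples $(\tilde x_{i,j},\tilde y_{i,j})$, where $(x_i,y_i)$ and $(x_j,y_j)$ are both randomly sampled from $\mathcal{D}_{train}$, follows the same long-tailed distribution as the original dataset $\mathcal{D}_{train}$: $$\mathbb{P}_{mixup}(Y^*=y_i)=\mathbb{P}^2(Y=y_i)+\mathbb{P}(Y=y_i)\iint_{y_i\neq y_j}Beta(\alpha,\alpha)\,\mathbb{P}(Y=y_j)\,d\xi\,dy_j=\frac{\lambda}{e^{-\lambda}-e^{-\lambda C}}\,e^{-\lambda y_i},\qquad y_i\in[1,C].$$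
   Context: $C$ is the number of classes. Classes are indexed in decreasing order of their number of instances, and the class index is treated as a variable ranging over $[1,C]$, with sums over classes written as integrals. $\rho$ is the imbalance factor of the training set: the number of instances of the most frequent class (index $1$) divided by that of the least frequent class (index $C$). $\mathbb{P}(Y=y_i)$ is the probability of class $y_i$ in $\mathcal{D}_{train}$. Given two samples $(x_i,y_i)$, $(x_j,y_j)$ and a mixing factor $\xi$, the virtual sample $\tilde x_{i,j}=\xi x_i+(1-\xi)x_j$, $\tilde y_{i,j}=\xi y_i+(1-\xi)y_j$ is called a $\xi$-Aug sample. It is a (robust) sample of class $y_i$ iff $\xi\ge 0.5$, and of class $y_j$ iff $\xi<0.5$, meaning that it contributes to that class in the model's feature learning. $\mathbb{P}_{mixup}(Y^*=y_i)$ is the probability that a $\xi$-Aug sample of $\mathcal{D}_\nu$ belongs to class $y_i$. In the double integral, $Beta(\alpha,\alpha)$ stands for the density of $\xi$, integrated over $0\le\xi\le1$, and $y_j$ ranges over the classes different from $y_i$. The quantities $\mathbb{P}(Y=y)$ are treated as class probabilities, so that $\int_{y_j\neq y_i}\mathbb{P}(Y=y_j)\,dy_j$ is taken to be $1-\mathbb{P}(Y=y_i)$. *)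

theory Defs
  imports "HOL-Probability.Probability"
begin

definition imbalance_factor :: "(nat \<Rightarrow> nat) \<Rightarrow> nat \<Rightarrow> real" where
  "imbalance_factor n C = real (n 1) / real (n C)"

(* The class index is a real variable in [1, C], so the class probabilities P(Y = y) form a
   function on that interval, and it is the Lebesgue density of the law of Y. *)
definition class_density :: "nat \<Rightarrow> (real \<Rightarrow> real) \<Rightarrow> real \<Rightarrow> ennreal" where
  "class_density C P y = ennreal (P y * indicator {1..real C} y)"

(* The sum over the classes different from y, written with an integral: the sum over all
   classes becomes the integral over [1, C] and the term of the class y is taken away from it.
   For a density P of total mass 1 the value is 1 - P y.  The Lebesgue integral over
   [1, C] - {y} would not see the excluded class, since a point is a null set. *)
definition integral_other_classes :: "nat \<Rightarrow> real \<Rightarrow> (real \<Rightarrow> real) \<Rightarrow> real" where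
  "integral_other_classes C y f = (LINT c:{1..real C}|lborel. f c) - f y"

(* The law Beta(a, a).  For a = 0 there is no density, and the law is the weak limit for
   a tending to 0 from the right: the values 0 and 1 with probability 1/2 each. *)
definition beta_law :: "real \<Rightarrow> real measure" where
  "beta_law a =
     (if a = 0 then distr (measure_pmf (bernoulli_pmf (1/2))) borel of_bool
      else density lborel
        (\<lambda>t. ennreal (t powr (a - 1) * (1 - t) powr (a - 1) / Beta a a * indicator {0..1} t)))"

(* A labelled sample is a pair (x, y).  In the virtual sample the labels are mixed as one-hot
   vectors, that is, as the indicator functions of the two classes. *)
definition xi_aug ::
  "real \<Rightarrow> 'x::real_vector \<times> real \<Rightarrow> 'x \<times> real \<Rightarrow> 'x \<times> (real \<Rightarrow> real)" where
  "xi_aug \<xi> si sj =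
     (\<xi> *\<^sub>R fst si + (1 - \<xi>) *\<^sub>R fst sj,
      \<lambda>c. \<xi> * indicator {snd si} c + (1 - \<xi>) * indicator {snd sj} c)"

definition aug_class :: "real \<Rightarrow> 'x \<times> real \<Rightarrow> 'x \<times> real \<Rightarrow> real" where
  "aug_class \<xi> si sj = (if \<xi> \<ge> 1/2 then snd si else snd sj)"

(* The law of a virtual sample together with the class it belongs to, when the mixing factor
   and the two training samples are drawn independently. *)
definition mixed_dataset ::
  "real \<Rightarrow> ('x::euclidean_space \<times> real) measure \<Rightarrow> (('x \<times> (real \<Rightarrow> real)) \<times> real) measure" where
  "mixed_dataset a D =
     distr (beta_law a \<Otimes>\<^sub>M (D \<Otimes>\<^sub>M D))
       ((borel \<Otimes>\<^sub>M (\<Pi>\<^sub>M c\<in>UNIV. borel)) \<Otimes>\<^sub>M borel)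
       (\<lambda>(\<xi>, si, sj). (xi_aug \<xi> si sj, aug_class \<xi> si sj))"

end

theory Submission
  imports Defs
begin

text \<open>Given the mixing factor, the class of a virtual sample is the class of one of the two
  training samples. Both have the law of \<open>Y\<close>, so for any law of the mixing factor the class
  again has the law of \<open>Y\<close>. The formula of the theorem collapses to the same density
  since \<open>P\<close> has total mass 1 and \<open>P y * P y + P y * (1 - P y) = P y\<close>.\<close>

lemma sets_beta_law [measurable_cong]: "sets (beta_law a) = sets borel"
  by (simp add: beta_law_def)

text \<open>For \<open>a > 0\<close> this is Euler's integral for \<open>Beta a a\<close>. At
  \<open>a = 0\<close> the law is the image of a fair coin under \<open>of_bool\<close>, whose two
  values both lie in the closed interval.\<close>

lemma emeasure_beta_law_unit_interval:
  assumes "a \<ge> 0"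
  shows "emeasure (beta_law a) {0..1} = 1"
proof (cases "a = 0")
  case True
  have "of_bool -` {0..1::real} = (UNIV :: bool set)"
    by auto
  then show ?thesis
    using True measure_pmf.emeasure_space_1[of "bernoulli_pmf (1/2)"]
    by (simp add: beta_law_def emeasure_distr)
next
  case False
  with assms have a: "a > 0" by simp
  let ?g = "\<lambda>t::real. t powr (a - 1) * (1 - t) powr (a - 1)"
  have B: "Beta a a > 0"
    using a by (simp add: Beta_def)
  have "((\<lambda>t. ?g t / Beta a a) has_integral Beta a a / Beta a a) {0..1}"
    by (intro has_integral_divide has_integral_Beta_real a)
  then have *: "((\<lambda>t. ?g t / Beta a a) has_integral 1) {0..1}"
    using B by simp
  have "emeasure (beta_law a) {0..1}
      = (\<integral>\<^sup>+t. ennreal (?g t / Beta a a * indicator {0..1} t) * indicator {0..1} t \<partial>lborel)"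
    using False by (simp add: beta_law_def emeasure_density)
  \<comment> \<open>The density already carries the indicator of the interval, so the two indicators
    merge into one.\<close>
  also have "\<dots> = (\<integral>\<^sup>+t. ennreal (?g t / Beta a a) * indicator {0..1} t \<partial>lborel)"
    by (intro nn_integral_cong) (auto simp: indicator_def)
  also have "\<dots> = ennreal 1"
    using * B by (intro nn_integral_has_integral_lebesgue') auto
  finally show ?thesis by simp
qed

lemma prob_space_beta_law:
  assumes "a \<ge> 0"
  shows "prob_space (beta_law a)"
proof (cases "a = 0")
  case True
  then show ?thesis
    by (auto simp: beta_law_def intro!: measure_pmf.prob_space_distr)
next
  case False
  have "emeasure (beta_law a) UNIV = emeasure (beta_law a) {0..1}"
    using False by (auto simp: beta_law_def emeasure_density indicator_def intro!: nn_integral_cong)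
  moreover have "space (beta_law a) = UNIV"
    by (simp add: beta_law_def)
  ultimately show ?thesis
    using assms by (intro prob_spaceI) (simp add: emeasure_beta_law_unit_interval)
qed

text \<open>This removes the integral over the mixing factor from the double integral, whose
  integrand depends on the class alone. The closed interval catches the atoms at 0 and 1 when
  \<open>a = 0\<close>.\<close>

lemma set_integral_beta_law_const:
  fixes c :: real
  assumes "a \<ge> 0"
  shows "(LINT \<xi>:{0..1}|beta_law a. c) = c"
  using emeasure_beta_law_unit_interval[OF assms]
  by (simp add: set_lebesgue_integral_def measure_def sets_beta_law)

text \<open>The singleton moves with \<open>x\<close>, but \<open>c = f x\<close> can be read as
  \<open>f x\<close> lying in the fixed closed set \<open>{c}\<close>. The one-hot labels in
  \<open>xi_aug\<close> have this form in each coordinate.\<close>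

lemma borel_measurable_indicator_singleton [measurable]:
  fixes f :: "'a \<Rightarrow> 'b::t1_space"
  assumes [measurable]: "f \<in> borel_measurable M"
  shows "(\<lambda>x. indicator {f x} c :: real) \<in> borel_measurable M"
proof -
  have "(\<lambda>x. indicator {f x} c :: real) = (\<lambda>x. indicator {c} (f x))"
    by (auto simp: indicator_def)
  then show ?thesis by simp
qed

lemma measurable_xi_aug [measurable]:
  fixes g h :: "'a \<Rightarrow> 'x::euclidean_space \<times> real"
  assumes [measurable]: "f \<in> borel_measurable M"
    "g \<in> M \<rightarrow>\<^sub>M borel \<Otimes>\<^sub>M borel" "h \<in> M \<rightarrow>\<^sub>M borel \<Otimes>\<^sub>M borel"
  shows "(\<lambda>x. xi_aug (f x) (g x) (h x)) \<in> M \<rightarrow>\<^sub>M borel \<Otimes>\<^sub>M (\<Pi>\<^sub>M c\<in>UNIV. borel)"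
  unfolding xi_aug_def
  by (intro measurable_Pair measurable_PiM_single') auto

lemma measurable_aug_class [measurable]:
  fixes g h :: "'a \<Rightarrow> 'x::euclidean_space \<times> real"
  assumes [measurable]: "f \<in> borel_measurable M"
    "g \<in> M \<rightarrow>\<^sub>M borel \<Otimes>\<^sub>M borel" "h \<in> M \<rightarrow>\<^sub>M borel \<Otimes>\<^sub>M borel"
  shows "(\<lambda>x. aug_class (f x) (g x) (h x)) \<in> borel_measurable M"
  unfolding aug_class_def by measurable

text \<open>Splitting at 1/2 turns the law of the class into a mixture, with weights given by
  \<open>N\<close>, of two copies of the law of the label. The target \<open>lborel\<close> matches
  the form in which \<open>distributed\<close> states laws.\<close>

lemma distr_aug_class:
  fixes D :: "('x::euclidean_space \<times> real) measure"
  assumes "prob_space N" and [measurable_cong]: "sets N = sets borel"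
    and "prob_space D" and [measurable_cong]: "sets D = sets (borel \<Otimes>\<^sub>M borel)"
  shows "distr (N \<Otimes>\<^sub>M (D \<Otimes>\<^sub>M D)) lborel (\<lambda>(\<xi>, si, sj). aug_class \<xi> si sj) = distr D lborel snd"
    (is "distr ?M _ ?f = _")
proof (rule measure_eqI)
  interpret N: prob_space N by fact
  interpret D: prob_space D by fact
  interpret DD: pair_prob_space D D ..
  fix A assume "A \<in> sets (distr ?M lborel ?f)"
  then have [measurable]: "A \<in> sets borel" by simp
  let ?S = "snd -` A \<inter> space D"
  let ?H = "{1/2..} :: real set" and ?L = "{..<1/2} :: real set"
  have [measurable]: "?S \<in> sets D" by measurable
  have sp: "space N = UNIV"
    using assms(2) sets_eq_imp_space_eq by force
  \<comment> \<open>The preimage is a disjoint union of two boxes: in each, one sample has its label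
    in \<open>A\<close> and the other sample is free.\<close>
  have "?f -` A \<inter> space ?M = ?H \<times> (?S \<times> space D) \<union> ?L \<times> (space D \<times> ?S)"
    by (auto simp: space_pair_measure sp aug_class_def split: if_splits)
  then have "emeasure (distr ?M lborel ?f) A
      = emeasure ?M (?H \<times> (?S \<times> space D) \<union> ?L \<times> (space D \<times> ?S))"
    by (simp add: emeasure_distr)
  also have "\<dots> = emeasure ?M (?H \<times> (?S \<times> space D)) + emeasure ?M (?L \<times> (space D \<times> ?S))"
    by (intro plus_emeasure[symmetric]) auto
  \<comment> \<open>By independence each box has product measure, and the free sample contributes
    the factor 1.\<close>
  also have "\<dots> = emeasure N ?H * emeasure D ?S + emeasure N ?L * emeasure D ?S"
    by (simp add: DD.emeasure_pair_measure_Times D.emeasure_pair_measure_Times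
        D.emeasure_space_1)
  also have "\<dots> = (emeasure N ?H + emeasure N ?L) * emeasure D ?S"
    by (simp add: distrib_right)
  also have "emeasure N ?H + emeasure N ?L = emeasure N (?H \<union> ?L)"
    by (intro plus_emeasure) auto
  also have "?H \<union> ?L = space N"
    by (auto simp: sp)
  finally show "emeasure (distr ?M lborel ?f) A = emeasure (distr D lborel snd) A"
    by (simp add: N.emeasure_space_1 emeasure_distr)
qed simp

lemma distributed_snd_mixed_dataset:
  fixes D :: "('x::euclidean_space \<times> real) measure"
  assumes "a \<ge> 0" and "prob_space D" and [measurable_cong]: "sets D = sets (borel \<Otimes>\<^sub>M borel)"
    and Y: "distributed D lborel snd f"
  shows "distributed (mixed_dataset a D) lborel snd f"
proof -
  have "distr (mixed_dataset a D) lborel snd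
      = distr (beta_law a \<Otimes>\<^sub>M (D \<Otimes>\<^sub>M D)) lborel (\<lambda>(\<xi>, si, sj). aug_class \<xi> si sj)"
    unfolding mixed_dataset_def
    by (subst distr_distr) (auto simp: comp_def case_prod_unfold intro!: distr_cong)
  also have "\<dots> = distr D lborel snd"
    by (intro distr_aug_class prob_space_beta_law sets_beta_law assms)
  finally show ?thesis
    using Y by (auto simp: distributed_def mixed_dataset_def)
qed

text \<open>Normalisation follows from \<open>P\<close> being the density of a random variable: the
  preimage of the whole line has probability 1. Nonnegativity matters because \<open>ennreal\<close>
  truncates negative values to 0.\<close>

lemma set_integral_class_density:
  assumes "prob_space M" and "distributed M lborel X (class_density C P)"
    and "\<And>y. y \<in> {1..real C} \<Longrightarrow> P y \<ge> 0" and "set_borel_measurable lborel {1..real C} P"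
  shows "(LINT c:{1..real C}|lborel. P c) = 1"
proof -
  interpret prob_space M by fact
  have "(\<integral>\<^sup>+c. class_density C P c \<partial>lborel) = emeasure M (X -` UNIV \<inter> space M)"
    by (subst distributed_emeasure[OF assms(2)]) auto
  then have "(\<integral>\<^sup>+c. ennreal (P c * indicator {1..real C} c) \<partial>lborel) = 1"
    by (simp add: emeasure_space_1 class_density_def)
  moreover have "(LINT c:{1..real C}|lborel. P c)
      = enn2real (\<integral>\<^sup>+c. ennreal (indicator {1..real C} c * P c) \<partial>lborel)"
    using assms(3,4) unfolding set_lebesgue_integral_def set_borel_measurable_def real_scaleR_def
    by (intro integral_eq_nn_integral) (auto simp: indicator_def)
  ultimately show ?thesis by (simp add: mult.commute)
qed

theorem corollary1:
  fixes D :: "('x::euclidean_space \<times> real) measure"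
    and n :: "nat \<Rightarrow> nat" and C :: nat
    and P :: "real \<Rightarrow> real" and \<rho> lam \<alpha> :: real
  assumes "C \<ge> 2"
    and "\<And>i j. 1 \<le> i \<Longrightarrow> i \<le> j \<Longrightarrow> j \<le> C \<Longrightarrow> n j \<le> n i"
    and "n C > 0" and "n C < n 1"
    and "\<rho> = imbalance_factor n C"
    and "lam = ln \<rho> / (real C - 1)"
    and "prob_space D" and "sets D = sets (borel \<Otimes>\<^sub>M borel)"
    and "distributed D lborel snd (class_density C P)"
    and "\<And>y. y \<in> {1..real C} \<Longrightarrow>
           P y = lam / (exp (- lam) - exp (- lam * real C)) * exp (- lam * y)"
    and "\<alpha> \<in> {0..1}"
  shows "distributed (mixed_dataset \<alpha> D) lborel snd
           (class_density C (\<lambda>y. (P y)\<^sup>2 + P y *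
              integral_other_classes C y (\<lambda>yj. LINT \<xi>:{0..1}|beta_law \<alpha>. P yj)))
       \<and> (\<forall>y\<in>{1..real C}.
            (P y)\<^sup>2 + P y *
              integral_other_classes C y (\<lambda>yj. LINT \<xi>:{0..1}|beta_law \<alpha>. P yj)
            = lam / (exp (- lam) - exp (- lam * real C)) * exp (- lam * y))
       \<and> distributed (mixed_dataset \<alpha> D) lborel snd (class_density C P)"
proof -
  let ?Q = "\<lambda>y. (P y)\<^sup>2 + P y *
    integral_other_classes C y (\<lambda>yj. LINT \<xi>:{0..1}|beta_law \<alpha>. P yj)"
  let ?k = "lam / (exp (- lam) - exp (- lam * real C))"
  have \<alpha>: "\<alpha> \<ge> 0" using assms(11) by simp
  \<comment> \<open>The strict imbalance \<open>n C < n 1\<close> makes \<open>lam\<close> positive;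
    with \<open>C \<ge> 2\<close> the denominator of \<open>?k\<close> is then positive too, which
    gives the sign of \<open>P\<close>.\<close>
  have "\<rho> > 1"
    using assms(3-5) by (simp add: imbalance_factor_def)
  then have "lam > 0"
    using assms(1,6) by simp
  then have "?k > 0"
    using assms(1) by simp
  then have nonneg: "P y \<ge> 0" if "y \<in> {1..real C}" for y
    unfolding assms(10)[OF that] using \<open>?k > 0\<close> by (intro mult_nonneg_nonneg) auto
  \<comment> \<open>\<open>P\<close> is prescribed only on the class interval, so it is compared
    with the explicit exponential after multiplication by the indicator.\<close>
  have "set_borel_measurable lborel {1..real C} P
      \<longleftrightarrow> set_borel_measurable lborel {1..real C} (\<lambda>y. ?k * exp (- lam * y))"
    unfolding set_borel_measurable_def
    by (intro measurable_cong) (auto simp: assms(10) indicator_def simp del: mult_minus_left)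
  then have "set_borel_measurable lborel {1..real C} P"
    by (simp add: set_borel_measurable_def)
  with assms(7,9) nonneg have "(LINT c:{1..real C}|lborel. P c) = 1"
    by (intro set_integral_class_density) auto
  \<comment> \<open>The integral over the other classes is \<open>1 - P y\<close> for every real
    \<open>y\<close>, inside the class interval or not, so the equation can rewrite the density
    under its binder.\<close>
  then have Q: "?Q y = P y" for y
    by (simp add: integral_other_classes_def set_integral_beta_law_const[OF \<alpha>] algebra_simps
        power2_eq_square)
  have "distributed (mixed_dataset \<alpha> D) lborel snd (class_density C P)"
    by (intro distributed_snd_mixed_dataset \<alpha> assms(7-9))
  then show ?thesis
    unfolding Q using assms(10) by blast
qed

end
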